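(* There is a quantity $C_\mu^{\mathrm{Clarke}}=\mathrm{poly}(B,R,L_\ell,L_{\ell'},N,H)$ (a fixed polynomial in these quantities) such that the following holds. Let $\theta^*=(u_1^*,w_1^*,\dots,u_H^*,w_H^* )$ be an $\epsilon$-Clarke stationary point of $L$, i.e. $\mathrm{dist}(0,\partial_CL(\theta^* ))\le\epsilon$, with Euclidean norm $\|\theta^*\|=B$, satisfying SQ. For any $0<\delta\le C_\tau^{\mathrm{Clarke}}$ and any $(u_1,w_1,\dots,u_H,w_H)$ in the closed Euclidean ball $\mathbb{B}_\delta(\theta^* )$, if the output point $(\widehat u_1,\widehat w_1,\dots,\widehat u_H,\widehat w_H)$ of the rounding procedure (with input $(u_1,w_1,\dots,u_H,w_H)$ and $\delta$) satisfies SQ, then $$\mathrm{dist}\Big(0,\partial_CL(\widehat u_1,\widehat w_1,\dots,\widehat u_H,\widehat w_H)\Big)\le\epsilon+C_\mu^{\mathrm{Clarke}}\cdot\delta.$$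
   Context: Setting: data $\{(x_i,y_i)\}_{i=1}^N\subseteq\mathbb{R}^d\times\mathbb{R}$, $x_i\ne0$, $R=\max_i\|x_i\|$; $\ell:\mathbb{R}\times\mathbb{R}\to\mathbb{R}$ is smooth with locally Lipschitz gradient, and each $\ell_i(\cdot)=\ell(\cdot,y_i)$ is $L_\ell$-Lipschitz with $L_{\ell'}$-Lipschitz derivative $\ell_i'$. The loss is $$L(u_1,w_1,\dots,u_H,w_H)=\sum_{i=1}^N\ell_i\Big(\sum_{k=1}^Hu_k\max\{w_k^\top x_i,0\}\Big),\qquad u_k\in\mathbb{R},\ w_k\in\mathbb{R}^d.$$ Clarke subdifferential: $\partial_Cf(x)=\mathrm{Conv}\{s:\exists x'\to x,\nabla f(x')\text{ exists},\nabla f(x')\to s\}$. $\mathrm{dist}$ is Euclidean distance. SQ at a point $(u_1,w_1,\dots,u_H,w_H)$: with $\rho_i=\ell_i'(\sum_ku_k\max\{w_k^\top x_i,0\})$, $\mathcal I_k^+=\{i:w_k^\top x_i=0,u_k\rho_i\ge0\}$, $\mathcal I_k^-=\{i:w_k^\top x_i=0,u_k\rho_i<0\}$, one has $\mathrm{span}(\{x_i\}_{i\in\mathcal I_k^+})\cap\mathrm{span}(\{x_j\}_{j\in\mathcal I_k^-})=\{0\}$ for every $k\in[H]$ (empty span is $\{0\}$). Separation constant: $C_\tau^{\mathrm{Clarke}}=\frac1{4R}\min\{|x_i^\top w_k^*|:i\in[N],k\in[H],x_i^\top w_k^*\ne0\}$, equal to $+\infty$ if the set is empty (then $\delta$ is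 any positive real). Rounding procedure: $\widehat u_k=u_k$, and $\widehat w_k$ is the minimizer of $\|z-w_k\|^2$ over $z\in\mathbb{R}^d$ subject to $z^\top x_i\ge2R\delta$ for all $i$ with $x_i^\top w_k>R\delta$; $z^\top x_i\le-2R\delta$ for all $i$ with $x_i^\top w_k<-R\delta$; $z^\top x_i=0$ for all $i$ with $|x_i^\top w_k|\le R\delta$. *)

theory Defs
  imports "HOL-Analysis.Analysis"
begin

section \<open>Finitely supported sequences\<close>

text \<open>
  The polynomial in the theorem has to be chosen before the dimension \<open>d\<close>, the width \<open>H\<close> and the
  number of data points \<open>N\<close>, so these must be natural numbers inside the formula and cannot be
  type-indexed. Real \<open>n\<close>-space is therefore the subspace \<open>coord_space n UNIV\<close> of the inner product
  space \<open>real fseq\<close> of finitely supported sequences, whose inner product, norm and metric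
  restrict to the Euclidean ones. The construction is iterated for the weights: \<open>H\<close>-tuples of
  vectors in real \<open>d\<close>-space are elements of \<open>real fseq fseq\<close>.
\<close>

typedef (overloaded) 'a fseq = "{f :: nat \<Rightarrow> 'a::zero. finite {i. f i \<noteq> 0}}"
  morphisms coord Abs_fseq
  by (rule exI[of _ "\<lambda>_. 0"]) simp

setup_lifting type_definition_fseq

lemma finite_coord: "finite {i. coord x i \<noteq> 0}"
  using coord[of x] by simp

lemma fseq_eqI: "(\<And>i. coord x i = coord y i) \<Longrightarrow> x = y"
  by (simp add: coord_inject[symmetric] fun_eq_iff)

instantiation fseq :: (real_vector) real_vector
begin

lift_definition zero_fseq :: "'a fseq" is "\<lambda>_. 0" by simp

lift_definition plus_fseq :: "'a fseq \<Rightarrow> 'a fseq \<Rightarrow> 'a fseq" is "\<lambda>f g i. f i + g i"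
proof -
  fix f g :: "nat \<Rightarrow> 'a"
  assume "finite {i. f i \<noteq> 0}" "finite {i. g i \<noteq> 0}"
  then have "finite ({i. f i \<noteq> 0} \<union> {i. g i \<noteq> 0})" by simp
  then show "finite {i. f i + g i \<noteq> 0}" by (rule rev_finite_subset) auto
qed

lift_definition minus_fseq :: "'a fseq \<Rightarrow> 'a fseq \<Rightarrow> 'a fseq" is "\<lambda>f g i. f i - g i"
proof -
  fix f g :: "nat \<Rightarrow> 'a"
  assume "finite {i. f i \<noteq> 0}" "finite {i. g i \<noteq> 0}"
  then have "finite ({i. f i \<noteq> 0} \<union> {i. g i \<noteq> 0})" by simp
  then show "finite {i. f i - g i \<noteq> 0}" by (rule rev_finite_subset) auto
qed

lift_definition uminus_fseq :: "'a fseq \<Rightarrow> 'a fseq" is "\<lambda>f i. - f i" by simp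

lift_definition scaleR_fseq :: "real \<Rightarrow> 'a fseq \<Rightarrow> 'a fseq" is "\<lambda>r f i. r *\<^sub>R f i"
  by (rule finite_subset[rotated]) auto

instance
  by standard (transfer; simp add: fun_eq_iff algebra_simps)+

end

lemmas coord_simps [simp] =
  zero_fseq.rep_eq plus_fseq.rep_eq minus_fseq.rep_eq uminus_fseq.rep_eq scaleR_fseq.rep_eq

instantiation fseq :: (real_inner) real_inner
begin

definition inner_fseq :: "'a fseq \<Rightarrow> 'a fseq \<Rightarrow> real" where
  "inner_fseq x y = (\<Sum>i | coord x i \<noteq> 0. coord x i \<bullet> coord y i)"

definition norm_fseq :: "'a fseq \<Rightarrow> real" where
  "norm_fseq x = sqrt (x \<bullet> x)"

definition dist_fseq :: "'a fseq \<Rightarrow> 'a fseq \<Rightarrow> real" where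
  "dist_fseq x y = norm (x - y)"

definition sgn_fseq :: "'a fseq \<Rightarrow> 'a fseq" where
  "sgn_fseq x = x /\<^sub>R norm x"

definition uniformity_fseq :: "('a fseq \<times> 'a fseq) filter" where
  "uniformity_fseq = (INF e\<in>{0 <..}. principal {(x, y). dist x y < e})"

definition open_fseq :: "'a fseq set \<Rightarrow> bool" where
  "open_fseq U = (\<forall>x\<in>U. eventually (\<lambda>(x', y). x' = x \<longrightarrow> y \<in> U) uniformity)"

lemma inner_fseq_superset:
  assumes "finite A" "{i. coord x i \<noteq> 0} \<subseteq> A"
  shows "x \<bullet> y = (\<Sum>i\<in>A. coord x i \<bullet> coord (y :: 'a fseq) i)"
  unfolding inner_fseq_def using assms by (intro sum.mono_neutral_left) auto

instance
proof
  fix x y z :: "'a fseq" and r :: real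
  let ?A = "{i. coord x i \<noteq> 0} \<union> {i. coord y i \<noteq> 0}"
  have A: "finite ?A" by (simp add: finite_coord)
  note sup = inner_fseq_superset[OF A]
  have x: "x \<bullet> v = (\<Sum>i\<in>?A. coord x i \<bullet> coord v i)" for v by (rule sup) auto
  have y: "y \<bullet> v = (\<Sum>i\<in>?A. coord y i \<bullet> coord v i)" for v by (rule sup) auto
  have xy: "(x + y) \<bullet> v = (\<Sum>i\<in>?A. coord (x + y) i \<bullet> coord v i)" for v by (rule sup) auto
  have rx: "(r *\<^sub>R x) \<bullet> v = (\<Sum>i\<in>?A. coord (r *\<^sub>R x) i \<bullet> coord v i)" for v by (rule sup) auto
  show "x \<bullet> y = y \<bullet> x" unfolding x y by (simp add: inner_commute)
  show "(x + y) \<bullet> z = x \<bullet> z + y \<bullet> z"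
    unfolding x y xy by (simp add: inner_add_left sum.distrib)
  show "(r *\<^sub>R x) \<bullet> y = r * (x \<bullet> y)" unfolding x rx by (simp add: sum_distrib_left)
  show "0 \<le> x \<bullet> x" unfolding inner_fseq_def by (intro sum_nonneg) simp
  show "x \<bullet> x = 0 \<longleftrightarrow> x = 0"
    unfolding inner_fseq_def
    by (subst sum_nonneg_eq_0_iff) (auto simp: finite_coord intro: fseq_eqI)
qed (simp_all add: norm_fseq_def dist_fseq_def sgn_fseq_def uniformity_fseq_def open_fseq_def)

end

lift_definition fseq_of :: "nat \<Rightarrow> (nat \<Rightarrow> 'a) \<Rightarrow> 'a::zero fseq" is
  "\<lambda>n f i. if i < n then f i else 0"
  by (rule finite_subset[of _ "{..<n}" for n]) auto

definition coord_space :: "nat \<Rightarrow> 'a::zero set \<Rightarrow> 'a fseq set" where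
  "coord_space n S = {x. (\<forall>i<n. coord x i \<in> S) \<and> (\<forall>i\<ge>n. coord x i = 0)}"


section \<open>Clarke subdifferential\<close>

text \<open>Gradients and subdifferentials are those of \<open>f\<close> restricted to a finite-dimensional
  subspace \<open>V\<close>; on such a \<open>V\<close> the gradient is unique. For locally Lipschitz \<open>f\<close>, in particular
  for the loss below, the subdifferential is nonempty, so \<open>infdist\<close> (which is 0 on the empty
  set) is the genuine distance to it.\<close>

definition has_gradient_on ::
    "('a::real_inner \<Rightarrow> real) \<Rightarrow> 'a \<Rightarrow> 'a set \<Rightarrow> 'a \<Rightarrow> bool" where
  "has_gradient_on f g V x \<longleftrightarrow> g \<in> V \<and> (f has_derivative (\<lambda>h. h \<bullet> g)) (at x within V)"

definition clarke_subdiff ::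
    "'a::real_inner set \<Rightarrow> ('a \<Rightarrow> real) \<Rightarrow> 'a \<Rightarrow> 'a set" where
  "clarke_subdiff V f x = convex hull {s. \<exists>X G. (\<forall>n::nat. X n \<in> V \<and> has_gradient_on f (G n) V (X n))
     \<and> X \<longlonglongrightarrow> x \<and> G \<longlonglongrightarrow> s}"


section \<open>Two-layer ReLU networks\<close>

text \<open>Indices are zero-based: data points are \<open>i < N\<close>, neurons are \<open>k < H\<close>. The product type
  carries the Euclidean norm, so \<open>norm (u, w)\<close> is the norm of all stacked parameters.\<close>

type_synonym param = "real fseq \<times> real fseq fseq"

definition param_space :: "nat \<Rightarrow> nat \<Rightarrow> param set" where
  "param_space d H = coord_space H UNIV \<times> coord_space H (coord_space d UNIV)"

definition network :: "nat \<Rightarrow> param \<Rightarrow> real fseq \<Rightarrow> real" where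
  "network H \<theta> v = (\<Sum>k<H. coord (fst \<theta>) k * max (coord (snd \<theta>) k \<bullet> v) 0)"

definition loss ::
    "(real \<times> real \<Rightarrow> real) \<Rightarrow> nat \<Rightarrow> (nat \<Rightarrow> real fseq) \<Rightarrow> (nat \<Rightarrow> real) \<Rightarrow> nat \<Rightarrow> param \<Rightarrow> real" where
  "loss l N x y H \<theta> = (\<Sum>i<N. l (network H \<theta> (x i), y i))"

definition loss_slope ::
    "(real \<times> real \<Rightarrow> real) \<Rightarrow> (nat \<Rightarrow> real fseq) \<Rightarrow> (nat \<Rightarrow> real) \<Rightarrow> nat \<Rightarrow> param \<Rightarrow> nat \<Rightarrow> real" where
  "loss_slope l x y H \<theta> i = deriv (\<lambda>t. l (t, y i)) (network H \<theta> (x i))"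

definition SQ ::
    "(real \<times> real \<Rightarrow> real) \<Rightarrow> nat \<Rightarrow> (nat \<Rightarrow> real fseq) \<Rightarrow> (nat \<Rightarrow> real) \<Rightarrow> nat \<Rightarrow> param \<Rightarrow> bool" where
  "SQ l N x y H \<theta> \<longleftrightarrow> (\<forall>k<H.
     let Ip = {i. i < N \<and> coord (snd \<theta>) k \<bullet> x i = 0 \<and> coord (fst \<theta>) k * loss_slope l x y H \<theta> i \<ge> 0};
         Im = {i. i < N \<and> coord (snd \<theta>) k \<bullet> x i = 0 \<and> coord (fst \<theta>) k * loss_slope l x y H \<theta> i < 0}
     in span (x ` Ip) \<inter> span (x ` Im) = {0})"

definition data_radius :: "nat \<Rightarrow> (nat \<Rightarrow> real fseq) \<Rightarrow> real" where
  "data_radius N x = Max ((\<lambda>i. norm (x i)) ` {..<N})"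

definition separation_const :: "nat \<Rightarrow> (nat \<Rightarrow> real fseq) \<Rightarrow> nat \<Rightarrow> param \<Rightarrow> ereal" where
  "separation_const N x H \<theta> =
     (let S = {\<bar>x i \<bullet> coord (snd \<theta>) k\<bar> | i k. i < N \<and> k < H \<and> x i \<bullet> coord (snd \<theta>) k \<noteq> 0}
      in if S = {} then \<infinity> else ereal (1 / (4 * data_radius N x) * Min S))"

definition round_feasible ::
    "nat \<Rightarrow> nat \<Rightarrow> (nat \<Rightarrow> real fseq) \<Rightarrow> real \<Rightarrow> real fseq \<Rightarrow> real fseq set" where
  "round_feasible d N x \<delta> w =
     (let R = data_radius N x in
      {z \<in> coord_space d UNIV. \<forall>i<N.
         (x i \<bullet> w > R * \<delta> \<longrightarrow> z \<bullet> x i \<ge> 2 * R * \<delta>) \<and>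
         (x i \<bullet> w < - (R * \<delta>) \<longrightarrow> z \<bullet> x i \<le> - (2 * R * \<delta>)) \<and>
         (\<bar>x i \<bullet> w\<bar> \<le> R * \<delta> \<longrightarrow> z \<bullet> x i = 0)})"

text \<open>When \<open>\<delta>\<close> is below the separation constant of a point \<open>\<theta>s\<close> and \<open>\<theta>\<close> is \<open>\<delta>\<close>-close to \<open>\<theta>s\<close>, the
  weights of \<open>\<theta>s\<close> are feasible, so each feasible set is nonempty, closed and convex and the
  minimizer selected by \<open>ARG_MIN\<close> exists and is unique.\<close>

definition round_params ::
    "nat \<Rightarrow> nat \<Rightarrow> (nat \<Rightarrow> real fseq) \<Rightarrow> nat \<Rightarrow> real \<Rightarrow> param \<Rightarrow> param" where
  "round_params d N x H \<delta> \<theta> =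
     (fst \<theta>,
      fseq_of H (\<lambda>k. ARG_MIN (\<lambda>z. (norm (z - coord (snd \<theta>) k))\<^sup>2) z.
        z \<in> round_feasible d N x \<delta> (coord (snd \<theta>) k)))"

text \<open>``Smooth'' is read as continuously differentiable; continuity of the gradient is part of
  its local Lipschitz continuity.\<close>

definition locally_lipschitz_gradient :: "('a::real_inner \<Rightarrow> real) \<Rightarrow> bool" where
  "locally_lipschitz_gradient f \<longleftrightarrow>
     (\<exists>g. (\<forall>p. GDERIV f p :> g p) \<and> (\<forall>p. \<exists>r>0. \<exists>K. K-lipschitz_on (ball p r) g))"

end

theory Submission
  imports Defs
begin

text \<open>
  Cut the parameter space into closed polyhedral cones, one for each pattern of signs of the
  pre-activations \<open>w\<^sub>k \<bullet> x\<^sub>i\<close>. On a cone with pattern \<open>A\<close> the loss coincides with a function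
  \<open>cell_loss A\<close> that is differentiable everywhere, because its ReLUs are frozen to linear gates. The
  Clarke subdifferential at \<open>\<theta>\<close> is therefore the convex hull of the gradients \<open>cell_grad A \<theta>\<close>, where
  \<open>A\<close> runs through the full-dimensional cones that contain \<open>\<theta>\<close> (\<open>clarke_subdiff_loss\<close>). The delicate
  part is that the loss may happen to be differentiable on the boundary of a cone;
  its gradient there is still one of the \<open>cell_grad A\<close> (\<open>gradient_eq_cell_grad\<close>).

  Since \<open>\<delta>\<close> is below the separation constant, rounding recovers the sign of every
  pre-activation of the stationary point, zeros included, and moves it by at most \<open>2 * R * \<delta>\<close>
  (\<open>round_params_close\<close>). The stationary point and the rounded point hence lie in the same cones. Their
  subdifferentials are hulls over the same index set of patterns, and for each single pattern the
  map \<open>cell_grad A\<close> is Lipschitz with a constant that is polynomial in the data of the problem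
  (\<open>cell_grad_near\<close>). A convex combination of gradients at the stationary point is then close to
  the combination with the same weights at the rounded point (\<open>convex_hull_image_near\<close>), and
  the distance from the subdifferential to \<open>0\<close> grows by at most a multiple of \<open>\<delta>\<close>.
\<close>

section \<open>Finite-dimensional coordinates\<close>

lemma coord_fseq_of [simp]: "coord (fseq_of n f) i = (if i < n then f i else 0)"
  by transfer simp

lemma inner_coord_space_left:
  assumes "(a :: 'a::real_inner fseq) \<in> coord_space n UNIV"
  shows "a \<bullet> b = (\<Sum>i<n. coord a i \<bullet> coord b i)"
proof (rule inner_fseq_superset)
  show "{i. coord a i \<noteq> 0} \<subseteq> {..<n}"
  proof
    fix i assume "i \<in> {i. coord a i \<noteq> 0}"
    then show "i \<in> {..<n}" using assms by (cases "i < n") (simp_all add: coord_space_def)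
  qed
qed simp

lemma inner_fseq_of_right:
  "(h :: 'a::real_inner fseq) \<bullet> fseq_of n f = (\<Sum>i<n. coord h i \<bullet> f i)"
proof -
  have "fseq_of n f \<bullet> h = (\<Sum>i<n. coord (fseq_of n f) i \<bullet> coord h i)"
    by (rule inner_coord_space_left) (simp add: coord_space_def)
  then show ?thesis by (simp add: inner_commute)
qed

lemma norm_coord_le: "norm (coord (a :: 'a::real_inner fseq) i) \<le> norm a"
proof (cases "coord a i = 0")
  case False
  have "coord a i \<bullet> coord a i \<le> a \<bullet> a"
    unfolding inner_fseq_def using False finite_coord[of a] by (intro member_le_sum) auto
  then show ?thesis by (simp add: norm_eq_sqrt_inner)
qed simp

lemma bounded_linear_coord: "bounded_linear (\<lambda>a :: 'a::real_inner fseq. coord a i)"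
  by (rule bounded_linear_intro[where K = 1]) (auto simp: norm_coord_le)

lemma norm_le_sum_coord:
  assumes "(a :: 'a::real_inner fseq) \<in> coord_space n UNIV"
  shows "norm a \<le> (\<Sum>i<n. norm (coord a i))"
proof -
  have "norm a = L2_set (\<lambda>i. norm (coord a i)) {..<n}"
    by (simp add: norm_eq_sqrt_inner[of a] inner_coord_space_left[OF assms] L2_set_def
        power2_norm_eq_inner)
  then show ?thesis by (simp add: L2_set_le_sum)
qed

lemma subspace_coord_space: "subspace S \<Longrightarrow> subspace (coord_space n S)"
  by (simp add: subspace_def coord_space_def)

lemma subspace_param_space: "subspace (param_space d H)"
proof -
  have "subspace (coord_space H (coord_space d (UNIV :: real set)))"
    by (intro subspace_coord_space) simp
  then show ?thesis
    unfolding param_space_def by (intro subspace_Times subspace_coord_space) simp_all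
qed

text \<open>Compactness is proved by adding one coordinate at a time: \<open>(z, a) \<mapsto> z + a e\<^sub>n\<close> maps
  \<open>coord_space n S \<times> S\<close> continuously onto \<open>coord_space (Suc n) S\<close>. It is what makes the minimization
  in the rounding procedure attain its infimum, as the ambient space of finitely supported
  sequences is neither complete nor locally compact.\<close>
lemma compact_coord_space:
  fixes S :: "'a::real_inner set"
  assumes "compact S"
  shows "compact (coord_space n S)"
proof (induction n)
  case 0
  have "coord_space 0 S = {0}" by (auto simp: coord_space_def intro: fseq_eqI)
  then show ?case by simp
next
  case (Suc n)
  define e where "e = (\<lambda>a :: 'a. fseq_of (Suc n) (\<lambda>i. if i = n then a else 0))"
  have coord_e: "coord (e a) i = (if i = n then a else 0)" for a i by (simp add: e_def)
  have "bounded_linear e"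
  proof (rule bounded_linear_intro[where K = 1])
    fix a
    have "e a \<in> coord_space (Suc n) UNIV" by (simp add: coord_space_def coord_e)
    from norm_le_sum_coord[OF this] show "norm (e a) \<le> norm a * 1"
      by (simp add: coord_e)
  qed (auto intro!: fseq_eqI simp: coord_e)
  then have "continuous_on (coord_space n S \<times> S) (\<lambda>p. fst p + e (snd p))"
    by (intro continuous_on_add continuous_on_fst continuous_on_id
        bounded_linear.continuous_on[of e] continuous_on_snd)
  then have "compact ((\<lambda>p. fst p + e (snd p)) ` (coord_space n S \<times> S))"
    by (rule compact_continuous_image) (intro compact_Times Suc assms)
  moreover have "(\<lambda>p. fst p + e (snd p)) ` (coord_space n S \<times> S) = coord_space (Suc n) S"
  proof (intro set_eqI iffI)
    fix a assume a: "a \<in> coord_space (Suc n) S"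
    then have "a - e (coord a n) \<in> coord_space n S" "coord a n \<in> S"
      by (auto simp: coord_space_def coord_e)
    then show "a \<in> (\<lambda>p. fst p + e (snd p)) ` (coord_space n S \<times> S)"
      by (intro image_eqI[of _ _ "(a - e (coord a n), coord a n)"]) auto
  next
    fix a assume "a \<in> (\<lambda>p. fst p + e (snd p)) ` (coord_space n S \<times> S)"
    then obtain z b where "a = z + e b" "z \<in> coord_space n S" "b \<in> S" by auto
    then show "a \<in> coord_space (Suc n) S"
      by (simp add: coord_space_def coord_e less_Suc_eq)
  qed
  ultimately show ?case by simp
qed

section \<open>Distances between convex hulls\<close>

text \<open>The Minkowski sum of a convex set with the ball of radius \<open>c\<close> is convex. Hence closeness of corresponding generators passes to the hulls.\<close>
lemma convex_hull_image_near:
  fixes f g :: "'i \<Rightarrow> 'a::real_normed_vector"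
  assumes "\<And>i. i \<in> I \<Longrightarrow> dist (f i) (g i) \<le> c"
    and "a \<in> convex hull (f ` I)"
  shows "\<exists>b \<in> convex hull (g ` I). dist a b \<le> c"
proof -
  have "f i \<in> (\<Union>b \<in> convex hull (g ` I). \<Union>e \<in> cball 0 c. {b + e})" if "i \<in> I" for i
  proof -
    have "f i = g i + (f i - g i)" "g i \<in> convex hull (g ` I)" "f i - g i \<in> cball 0 c"
      using assms(1)[OF that] that by (auto simp: dist_norm hull_inc norm_minus_commute)
    then show ?thesis by blast
  qed
  then have "convex hull (f ` I) \<subseteq> (\<Union>b \<in> convex hull (g ` I). \<Union>e \<in> cball 0 c. {b + e})"
    by (intro hull_minimal image_subsetI convex_sums convex_convex_hull convex_cball) auto
  then obtain b e where "a = b + e" "b \<in> convex hull (g ` I)" "e \<in> cball 0 c"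
    using assms(2) by blast
  then show ?thesis by (intro bexI[of _ b]) (auto simp: dist_norm)
qed

lemma infdist_le_infdist_add:
  assumes "A \<noteq> {}" "\<And>a. a \<in> A \<Longrightarrow> \<exists>b\<in>B. dist a b \<le> c"
  shows "infdist p B \<le> infdist p A + c"
proof -
  have "infdist p B - c \<le> dist p a" if "a \<in> A" for a
  proof -
    obtain b where "b \<in> B" "dist a b \<le> c" using assms(2) \<open>a \<in> A\<close> by blast
    then have "infdist p B \<le> dist p b" by (intro infdist_le)
    also have "\<dots> \<le> dist p a + dist a b" by (rule dist_triangle)
    finally show ?thesis using \<open>dist a b \<le> c\<close> by simp
  qed
  then have "infdist p B - c \<le> infdist p A"
    using assms(1) by (simp add: infdist_def[of p A] cINF_greatest)
  then show ?thesis by simp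
qed

section \<open>Small perturbations and directional derivatives\<close>

lemma ex_small_step:
  fixes a h :: "'a::real_normed_vector"
  assumes "eventually P (nhds a)"
  shows "\<exists>t>0. P (a + t *\<^sub>R h)"
proof -
  have "((\<lambda>t. a + t *\<^sub>R h) \<longlongrightarrow> a + 0 *\<^sub>R h) (at_right 0)"
    by (intro tendsto_add tendsto_const tendsto_scaleR tendsto_ident_at)
  then have "filterlim (\<lambda>t. a + t *\<^sub>R h) (nhds a) (at_right 0)" by simp
  with assms have "\<forall>\<^sub>F t in at_right 0. P (a + t *\<^sub>R h)"
    by (rule eventually_compose_filterlim)
  then have "\<forall>\<^sub>F t in at_right 0. t > 0 \<and> P (a + t *\<^sub>R h)"
    by (intro eventually_conj eventually_at_right_less)
  then show ?thesis by (rule eventually_happens'[rotated]) simp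
qed

text \<open>Finitely many hyperplanes do not cover a space. Inductively, a vector that avoids the first
  \<open>n\<close> hyperplanes but lies on the next one is pushed off it along its normal \<open>x n\<close>, by so little that
  it stays off the others.\<close>
lemma ex_inner_nonzero:
  fixes x :: "nat \<Rightarrow> 'a::real_inner"
  assumes "subspace S" "\<And>i. i < n \<Longrightarrow> x i \<in> S" "\<And>i. i < n \<Longrightarrow> x i \<noteq> 0"
  shows "\<exists>v\<in>S. \<forall>i<n. v \<bullet> x i \<noteq> 0"
  using assms(2,3)
proof (induction n)
  case 0
  then show ?case using subspace_0[OF assms(1)] by auto
next
  case (Suc n)
  then obtain v where v: "v \<in> S" "\<And>i. i < n \<Longrightarrow> v \<bullet> x i \<noteq> 0" by auto
  show ?case
  proof (cases "v \<bullet> x n = 0")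
    case True
    have "\<forall>\<^sub>F v' in nhds v. \<forall>i\<in>{..<n}. v' \<bullet> x i \<noteq> 0"
    proof (intro eventually_ball_finite ballI finite_lessThan)
      fix i assume "i \<in> {..<n}"
      moreover have "((\<lambda>v'. v' \<bullet> x i) \<longlongrightarrow> v \<bullet> x i) (nhds v)"
        by (intro tendsto_inner tendsto_const filterlim_ident)
      ultimately show "\<forall>\<^sub>F v' in nhds v. v' \<bullet> x i \<noteq> 0"
        using v(2)[of i] by (intro tendsto_imp_eventually_ne) auto
    qed
    then have "\<exists>t>0. \<forall>i\<in>{..<n}. (v + t *\<^sub>R x n) \<bullet> x i \<noteq> 0"
      by (rule ex_small_step)
    then obtain t :: real where t: "t > 0" "\<And>i. i < n \<Longrightarrow> (v + t *\<^sub>R x n) \<bullet> x i \<noteq> 0"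
      by blast
    moreover have "(v + t *\<^sub>R x n) \<bullet> x n \<noteq> 0"
      using True t(1) Suc.prems(2)[of n] by (simp add: inner_add_left)
    moreover have "v + t *\<^sub>R x n \<in> S"
      using v(1) Suc.prems(1)[of n] assms(1) by (simp add: subspace_add subspace_scale)
    ultimately show ?thesis by (metis less_Suc_eq)
  next
    case False
    then show ?thesis using v by (metis less_Suc_eq)
  qed
qed

text \<open>One-sided derivatives along segments suffice to identify gradients, and they
  remain available at a boundary point \<open>a\<close> of a convex region on which \<open>f\<close> agrees with another
  function.\<close>
lemma has_real_derivative_along_segment:
  fixes f :: "'a::real_inner \<Rightarrow> real"
  assumes "(f has_derivative (\<lambda>h. h \<bullet> g)) (at a within S)"
    and "\<And>t. 0 \<le> t \<Longrightarrow> t \<le> 1 \<Longrightarrow> a + t *\<^sub>R v \<in> S"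
  shows "((\<lambda>t. f (a + t *\<^sub>R v)) has_real_derivative v \<bullet> g) (at 0 within {0..1})"
proof -
  have "((\<lambda>t. a + t *\<^sub>R v) has_derivative (\<lambda>t. t *\<^sub>R v)) (at 0 within {0..1})"
    by (auto intro!: derivative_eq_intros)
  moreover have "(f has_derivative (\<lambda>h. h \<bullet> g)) (at (a + 0 *\<^sub>R v) within (\<lambda>t. a + t *\<^sub>R v) ` {0..1})"
    using has_derivative_subset[OF assms(1)] assms(2) by (simp add: image_subset_iff)
  ultimately have "((\<lambda>t. f (a + t *\<^sub>R v)) has_derivative (\<lambda>t. (t *\<^sub>R v) \<bullet> g)) (at 0 within {0..1})"
    by (rule has_derivative_in_compose)
  then show ?thesis
    unfolding has_field_derivative_def by (simp add: mult_commute_abs)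
qed

lemma lipschitz_on_imp_abs_deriv_le:
  fixes f :: "real \<Rightarrow> real"
  assumes "C-lipschitz_on UNIV f" "f differentiable at t"
  shows "\<bar>deriv f t\<bar> \<le> C"
proof (rule tendsto_upperbound)
  have "(f has_real_derivative deriv f t) (at t)"
    using assms(2) by (simp add: DERIV_deriv_iff_real_differentiable)
  then show "((\<lambda>h. \<bar>(f (t + h) - f t) / h\<bar>) \<longlongrightarrow> \<bar>deriv f t\<bar>) (at 0)"
    by (intro tendsto_rabs) (simp add: DERIV_def)
  show "\<forall>\<^sub>F h in at 0. \<bar>(f (t + h) - f t) / h\<bar> \<le> C"
  proof (rule eventually_at_filter[THEN iffD2], rule always_eventually, safe)
    fix h :: real assume "h \<noteq> 0"
    then show "\<bar>(f (t + h) - f t) / h\<bar> \<le> C"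
      using lipschitz_onD[OF assms(1), of "t + h" t] by (simp add: dist_real_def divide_simps)
  qed
qed simp

lemma abs_mult_diff_le:
  fixes a b a' b' :: real
  assumes "\<bar>a - a'\<bar> \<le> p" "\<bar>b\<bar> \<le> q" "\<bar>a'\<bar> \<le> r" "\<bar>b - b'\<bar> \<le> s"
  shows "\<bar>a * b - a' * b'\<bar> \<le> p * q + r * s"
proof -
  have "a * b - a' * b' = (a - a') * b + a' * (b - b')" by (simp add: algebra_simps)
  moreover have "\<bar>(a - a') * b\<bar> \<le> p * q" "\<bar>a' * (b - b')\<bar> \<le> r * s"
    using assms unfolding abs_mult by (intro mult_mono; force)+
  ultimately show ?thesis by linarith
qed

section \<open>Freezing the activation pattern\<close>

text \<open>An activation pattern is a set of pairs (neuron, data point), and a pattern \<open>A\<close> determines the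
  closed polyhedral cone \<open>cell A\<close> of parameters compatible with it. The loss is smooth on each cell:
  there it equals \<open>cell_loss A\<close>, the loss of the network whose ReLUs are replaced by linear gates that
  are open exactly on \<open>A\<close>. This surrogate is differentiable on the whole space, so that its gradient
  can be evaluated on the boundary of the cell, where the loss itself has kinks.\<close>
locale relu_network =
  fixes l :: "real \<times> real \<Rightarrow> real" and d N H :: nat
    and x :: "nat \<Rightarrow> real fseq" and y :: "nat \<Rightarrow> real" and L0 L1 :: real
  assumes N_pos: "N > 0"
    and data_space: "\<And>i. i < N \<Longrightarrow> x i \<in> coord_space d UNIV"
    and data_nonzero: "\<And>i. i < N \<Longrightarrow> x i \<noteq> 0"
    and loss_differentiable: "\<And>i t. i < N \<Longrightarrow> (\<lambda>t. l (t, y i)) differentiable at t"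
    and loss_lipschitz: "\<And>i. i < N \<Longrightarrow> L0-lipschitz_on UNIV (\<lambda>t. l (t, y i))"
    and slope_lipschitz: "\<And>i. i < N \<Longrightarrow> L1-lipschitz_on UNIV (deriv (\<lambda>t. l (t, y i)))"
begin

definition preact :: "param \<Rightarrow> nat \<Rightarrow> nat \<Rightarrow> real" where
  "preact \<theta> k i = coord (snd \<theta>) k \<bullet> x i"

definition cell_act :: "(nat \<times> nat) set \<Rightarrow> param \<Rightarrow> nat \<Rightarrow> nat \<Rightarrow> real" where
  "cell_act A \<theta> k i = of_bool ((k, i) \<in> A) * preact \<theta> k i"

definition cell_output :: "(nat \<times> nat) set \<Rightarrow> param \<Rightarrow> nat \<Rightarrow> real" where
  "cell_output A \<theta> i = (\<Sum>k<H. coord (fst \<theta>) k * cell_act A \<theta> k i)"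

definition cell_slope :: "(nat \<times> nat) set \<Rightarrow> param \<Rightarrow> nat \<Rightarrow> real" where
  "cell_slope A \<theta> i = deriv (\<lambda>t. l (t, y i)) (cell_output A \<theta> i)"

definition cell_loss :: "(nat \<times> nat) set \<Rightarrow> param \<Rightarrow> real" where
  "cell_loss A \<theta> = (\<Sum>i<N. l (cell_output A \<theta> i, y i))"

definition cell_grad :: "(nat \<times> nat) set \<Rightarrow> param \<Rightarrow> param" where
  "cell_grad A \<theta> =
     (fseq_of H (\<lambda>k. \<Sum>i<N. cell_slope A \<theta> i * cell_act A \<theta> k i),
      fseq_of H (\<lambda>k. \<Sum>i<N. (cell_slope A \<theta> i * coord (fst \<theta>) k * of_bool ((k, i) \<in> A)) *\<^sub>R x i))"

definition cell :: "(nat \<times> nat) set \<Rightarrow> param set" where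
  "cell A = {\<theta> \<in> param_space d H. \<forall>k<H. \<forall>i<N.
     if (k, i) \<in> A then preact \<theta> k i \<ge> 0 else preact \<theta> k i \<le> 0}"

definition generic :: "param \<Rightarrow> bool" where
  "generic Z \<longleftrightarrow> Z \<in> param_space d H \<and> (\<forall>k<H. \<forall>i<N. preact Z k i \<noteq> 0)"

definition pattern :: "param \<Rightarrow> (nat \<times> nat) set" where
  "pattern Z = {(k, i). k < H \<and> i < N \<and> preact Z k i > 0}"

text \<open>These are the patterns of the full-dimensional cells that contain \<open>\<theta>\<close>, the only ones that matter
  for limits of gradients; a degenerate cell such as \<open>{\<theta>. preact \<theta> k i = 0}\<close>, which arises from contradictory gates on
  \<open>x i\<close> and \<open>- x i\<close> or on repeated data points, is excluded by asking for a generic point.\<close>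
definition adjacent :: "param \<Rightarrow> (nat \<times> nat) set set" where
  "adjacent \<theta> = {pattern Z | Z. generic Z \<and> \<theta> \<in> cell (pattern Z)}"

lemma bounded_linear_preact: "bounded_linear (\<lambda>\<theta>. preact \<theta> k i)"
  unfolding preact_def
  by (intro bounded_linear_compose[OF bounded_linear_inner_left]
      bounded_linear_compose[OF bounded_linear_coord] bounded_linear_snd)

lemma bounded_linear_outer: "bounded_linear (\<lambda>\<theta> :: param. coord (fst \<theta>) k)"
  by (intro bounded_linear_compose[OF bounded_linear_coord] bounded_linear_fst)

lemma preact_add: "preact (\<theta> + \<theta>') k i = preact \<theta> k i + preact \<theta>' k i"
  and preact_diff: "preact (\<theta> - \<theta>') k i = preact \<theta> k i - preact \<theta>' k i"
  and preact_scaleR: "preact (r *\<^sub>R \<theta>) k i = r * preact \<theta> k i"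
  by (simp_all add: preact_def inner_add_left inner_diff_left)

lemma tendsto_preact: "(f \<longlongrightarrow> \<theta>) F \<Longrightarrow> ((\<lambda>t. preact (f t) k i) \<longlongrightarrow> preact \<theta> k i) F"
  by (rule bounded_linear.tendsto[OF bounded_linear_preact])

lemma cell_grad_in_param_space: "cell_grad A \<theta> \<in> param_space d H"
proof -
  have "(\<Sum>i<N. c i *\<^sub>R x i) \<in> coord_space d UNIV" for c :: "nat \<Rightarrow> real"
    using subspace_coord_space[OF subspace_UNIV, of d] data_space
    by (intro subspace_sum subspace_scale) auto
  then show ?thesis
    by (simp add: cell_grad_def param_space_def coord_space_def[of H])
qed

lemma cell_loss_has_derivative:
  "(cell_loss A has_derivative (\<lambda>h. h \<bullet> cell_grad A \<theta>)) (at \<theta>)"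
proof -
  define D where "D h i = (\<Sum>k<H. coord (fst \<theta>) k * (of_bool ((k, i) \<in> A) * preact h k i)
    + coord (fst h) k * cell_act A \<theta> k i)" for h i
  have out: "((\<lambda>\<theta>. cell_output A \<theta> i) has_derivative (\<lambda>h. D h i)) (at \<theta>)" for i
    unfolding cell_output_def D_def cell_act_def
    by (intro has_derivative_sum has_derivative_mult has_derivative_mult_right
        bounded_linear_imp_has_derivative bounded_linear_preact bounded_linear_outer)
  have "((\<lambda>\<theta>. l (cell_output A \<theta> i, y i)) has_derivative (\<lambda>h. D h i * cell_slope A \<theta> i)) (at \<theta>)"
    if "i < N" for i
  proof -
    have "((\<lambda>t. l (t, y i)) has_derivative (\<lambda>s. s * cell_slope A \<theta> i)) (at (cell_output A \<theta> i))"
      using loss_differentiable[OF that]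
      unfolding cell_slope_def mult.commute[of _ "deriv _ _"]
      by (simp add: DERIV_deriv_iff_real_differentiable flip: has_field_derivative_def)
    from has_derivative_compose[OF out this] show ?thesis .
  qed
  then have "(cell_loss A has_derivative (\<lambda>h. \<Sum>i<N. D h i * cell_slope A \<theta> i)) (at \<theta>)"
    unfolding cell_loss_def by (intro has_derivative_sum) simp
  moreover have "(\<Sum>i<N. D h i * cell_slope A \<theta> i) = h \<bullet> cell_grad A \<theta>" for h
  proof -
    have "h \<bullet> cell_grad A \<theta> = (\<Sum>k<H. \<Sum>i<N. coord (fst h) k * (cell_slope A \<theta> i * cell_act A \<theta> k i)
      + (cell_slope A \<theta> i * coord (fst \<theta>) k * of_bool ((k, i) \<in> A)) * preact h k i)"
      by (simp add: cell_grad_def inner_prod_def inner_fseq_of_right inner_sum_right preact_def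
          sum_distrib_left flip: sum.distrib)
    also have "\<dots> = (\<Sum>i<N. \<Sum>k<H. coord (fst h) k * (cell_slope A \<theta> i * cell_act A \<theta> k i)
      + (cell_slope A \<theta> i * coord (fst \<theta>) k * of_bool ((k, i) \<in> A)) * preact h k i)"
      by (rule sum.swap)
    also have "\<dots> = (\<Sum>i<N. D h i * cell_slope A \<theta> i)"
      unfolding D_def sum_distrib_right by (intro sum.cong refl) (simp add: algebra_simps)
    finally show ?thesis ..
  qed
  ultimately show ?thesis by simp
qed

lemma loss_eq_cell_loss:
  assumes "\<theta> \<in> cell A"
  shows "loss l N x y H \<theta> = cell_loss A \<theta>"
proof -
  have "max (preact \<theta> k i) 0 = cell_act A \<theta> k i" if "k < H" "i < N" for k i
  proof -
    have "if (k, i) \<in> A then preact \<theta> k i \<ge> 0 else preact \<theta> k i \<le> 0"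
      using assms that by (simp add: cell_def)
    then show ?thesis by (auto simp: cell_act_def max_def split: if_splits)
  qed
  then show ?thesis
    by (simp add: loss_def network_def cell_loss_def cell_output_def flip: preact_def)
qed

lemma generic_in_cell: "generic Z \<Longrightarrow> Z \<in> cell (pattern Z)"
  by (auto simp: generic_def cell_def pattern_def not_less)

lemma cell_segment:
  assumes "\<theta> \<in> cell A" "\<theta>' \<in> cell A" "0 \<le> t" "t \<le> 1"
  shows "\<theta> + t *\<^sub>R (\<theta>' - \<theta>) \<in> cell A"
proof -
  have eq: "preact (\<theta> + t *\<^sub>R (\<theta>' - \<theta>)) k i = (1 - t) * preact \<theta> k i + t * preact \<theta>' k i" for k i
    by (simp add: preact_add preact_scaleR preact_diff algebra_simps)
  have "\<theta> + t *\<^sub>R (\<theta>' - \<theta>) \<in> param_space d H"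
    using assms subspace_param_space[of d H]
    by (auto simp: cell_def intro!: subspace_add subspace_scale subspace_diff)
  moreover have "0 \<le> (1 - t) * a + t * b" if "0 \<le> a" "0 \<le> b" for a b
    using assms(3,4) that by simp
  moreover have "(1 - t) * a + t * b \<le> 0" if "a \<le> 0" "b \<le> 0" for a b
    using assms(3,4) that by (intro add_nonpos_nonpos mult_nonneg_nonpos) auto
  ultimately show ?thesis
    using assms(1,2) by (auto simp: cell_def eq)
qed

text \<open>From any point of a closed cell one can move into its interior along a segment. This
  approximates a kink by points at which the loss is differentiable and equal to the prescribed
  smooth piece.\<close>
lemma generic_segment:
  assumes "generic Z" "\<theta> \<in> cell (pattern Z)" "0 < t" "t \<le> 1"
  shows "generic (\<theta> + t *\<^sub>R (Z - \<theta>))" "pattern (\<theta> + t *\<^sub>R (Z - \<theta>)) = pattern Z"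
proof -
  let ?Y = "\<theta> + t *\<^sub>R (Z - \<theta>)"
  have eq: "preact ?Y k i = (1 - t) * preact \<theta> k i + t * preact Z k i" for k i
    by (simp add: preact_add preact_scaleR preact_diff algebra_simps)
  have pos: "preact ?Y k i > 0" if "k < H" "i < N" "preact Z k i > 0" for k i
  proof -
    have "preact \<theta> k i \<ge> 0" using assms(2) that by (auto simp: cell_def pattern_def)
    then show ?thesis using assms(3,4) that by (simp add: eq add_nonneg_pos)
  qed
  have neg: "preact ?Y k i < 0" if "k < H" "i < N" "preact Z k i < 0" for k i
  proof -
    have "preact \<theta> k i \<le> 0" using assms(2) that by (auto simp: cell_def pattern_def)
    then show ?thesis using assms(3,4) that
      unfolding eq by (intro add_nonpos_neg mult_nonneg_nonpos mult_pos_neg) auto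
  qed
  have "?Y \<in> param_space d H"
    using cell_segment[OF assms(2) generic_in_cell[OF assms(1)], of t] assms(3,4)
    by (simp add: cell_def)
  then show "generic ?Y"
    using assms(1) pos neg unfolding generic_def by (metis less_irrefl linorder_neqE_linordered_idom)
  have "preact ?Y k i > 0 \<longleftrightarrow> preact Z k i > 0" if "k < H" "i < N" for k i
    using assms(1) pos[OF that] neg[OF that] that unfolding generic_def
    by (metis less_asym linorder_neqE_linordered_idom)
  then show "pattern ?Y = pattern Z"
    unfolding pattern_def by blast
qed

lemma eventually_sign_preact:
  "\<forall>\<^sub>F \<theta>' in nhds \<theta>. \<forall>k<H. \<forall>i<N.
     (preact \<theta> k i > 0 \<longrightarrow> preact \<theta>' k i > 0) \<and> (preact \<theta> k i < 0 \<longrightarrow> preact \<theta>' k i < 0)"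
proof -
  have "\<forall>\<^sub>F \<theta>' in nhds \<theta>. \<forall>k\<in>{..<H}. \<forall>i\<in>{..<N}.
     (preact \<theta> k i > 0 \<longrightarrow> preact \<theta>' k i > 0) \<and> (preact \<theta> k i < 0 \<longrightarrow> preact \<theta>' k i < 0)"
  proof (intro eventually_ball_finite ballI finite_lessThan eventually_conj)
    fix k i
    have lim: "((\<lambda>\<theta>'. preact \<theta>' k i) \<longlongrightarrow> preact \<theta> k i) (nhds \<theta>)"
      by (intro tendsto_preact tendsto_ident_at filterlim_ident)
    show "\<forall>\<^sub>F \<theta>' in nhds \<theta>. preact \<theta> k i > 0 \<longrightarrow> preact \<theta>' k i > 0"
      using order_tendstoD(1)[OF lim, of 0] by (cases "preact \<theta> k i > 0") auto
    show "\<forall>\<^sub>F \<theta>' in nhds \<theta>. preact \<theta> k i < 0 \<longrightarrow> preact \<theta>' k i < 0"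
      using order_tendstoD(2)[OF lim, of 0] by (cases "preact \<theta> k i < 0") auto
  qed
  then show ?thesis by (simp add: Ball_def)
qed

lemma eventually_in_cell_pattern:
  assumes "generic Z"
  shows "\<forall>\<^sub>F \<theta> in nhds Z. \<theta> \<in> param_space d H \<longrightarrow> \<theta> \<in> cell (pattern Z)"
  using eventually_sign_preact[of Z]
proof (rule eventually_mono)
  fix \<theta>
  assume *: "\<forall>k<H. \<forall>i<N.
     (preact Z k i > 0 \<longrightarrow> preact \<theta> k i > 0) \<and> (preact Z k i < 0 \<longrightarrow> preact \<theta> k i < 0)"
  have "if (k, i) \<in> pattern Z then preact \<theta> k i \<ge> 0 else preact \<theta> k i \<le> 0" if "k < H" "i < N" for k i
  proof (cases "preact Z k i > 0")
    case False
    then have "preact Z k i < 0" using assms that by (force simp: generic_def)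
    then show ?thesis using * that False by (auto simp: pattern_def less_imp_le)
  qed (use * that in \<open>auto simp: pattern_def less_imp_le\<close>)
  then show "\<theta> \<in> param_space d H \<longrightarrow> \<theta> \<in> cell (pattern Z)"
    by (simp add: cell_def)
qed

lemma has_gradient_at_generic:
  assumes "generic Z"
  shows "has_gradient_on (loss l N x y H) (cell_grad (pattern Z) Z) (param_space d H) Z"
  unfolding has_gradient_on_def
proof (intro conjI cell_grad_in_param_space)
  show "(loss l N x y H has_derivative (\<lambda>h. h \<bullet> cell_grad (pattern Z) Z)) (at Z within param_space d H)"
  proof (rule has_derivative_transform_eventually)
    show "(cell_loss (pattern Z) has_derivative (\<lambda>h. h \<bullet> cell_grad (pattern Z) Z))
        (at Z within param_space d H)"
      by (rule has_derivative_at_withinI[OF cell_loss_has_derivative])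
    show "\<forall>\<^sub>F \<theta> in at Z within param_space d H. cell_loss (pattern Z) \<theta> = loss l N x y H \<theta>"
      unfolding eventually_at_filter
      using eventually_in_cell_pattern[OF assms]
      by (rule eventually_mono) (simp add: loss_eq_cell_loss[of _ "pattern Z"])
    show "cell_loss (pattern Z) Z = loss l N x y H Z"
      by (simp add: loss_eq_cell_loss[OF generic_in_cell[OF assms]])
    show "Z \<in> param_space d H" using assms by (simp add: generic_def)
  qed
qed

text \<open>The loss can be differentiable even on the boundary of a cell, for example where an output
  weight or a loss slope vanishes, so gradients near a kink need not come from interior points.
  They produce nothing new, though. The loss and the smooth piece \<open>cell_loss\<close> agree along every
  segment from \<open>\<theta>\<close> into the cell, so their gradients have the same inner product with all directions
  into the cell. As the cell has interior, these directions span the parameter space.\<close>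
lemma gradient_eq_cell_grad:
  assumes "has_gradient_on (loss l N x y H) G (param_space d H) \<theta>"
    and "generic Z" "\<theta> \<in> cell (pattern Z)"
  shows "G = cell_grad (pattern Z) \<theta>"
proof -
  let ?g = "cell_grad (pattern Z) \<theta>"
  have dir: "(W - \<theta>) \<bullet> G = (W - \<theta>) \<bullet> ?g" if "W \<in> cell (pattern Z)" for W
  proof -
    have seg: "\<theta> + t *\<^sub>R (W - \<theta>) \<in> cell (pattern Z)" if "0 \<le> t" "t \<le> 1" for t
      using cell_segment assms(3) \<open>W \<in> _\<close> that by blast
    have "((\<lambda>t. loss l N x y H (\<theta> + t *\<^sub>R (W - \<theta>))) has_real_derivative (W - \<theta>) \<bullet> G)
        (at 0 within {0..1})"
      using assms(1) seg unfolding has_gradient_on_def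
      by (intro has_real_derivative_along_segment[where S = "param_space d H"])
        (auto simp: cell_def)
    moreover have "((\<lambda>t. cell_loss (pattern Z) (\<theta> + t *\<^sub>R (W - \<theta>))) has_real_derivative (W - \<theta>) \<bullet> ?g)
        (at 0 within {0..1})"
      by (intro has_real_derivative_along_segment[where S = UNIV]) (simp_all add: cell_loss_has_derivative)
    then have "((\<lambda>t. loss l N x y H (\<theta> + t *\<^sub>R (W - \<theta>))) has_real_derivative (W - \<theta>) \<bullet> ?g)
        (at 0 within {0..1})"
      by (rule has_field_derivative_transform_within[OF _ zero_less_one])
        (auto simp: loss_eq_cell_loss[OF seg])
    moreover have "at (0::real) within {0..1} \<noteq> bot"
      by (simp add: at_within_Icc_at_right)
    ultimately show ?thesis
      using vector_derivative_unique_within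
      by (metis has_real_derivative_iff_has_vector_derivative)
  qed
  \<comment> \<open>Comparing the directions towards \<open>Z\<close> and towards \<open>Z + t ?h\<close> isolates \<open>?h \<bullet> ?h\<close>.\<close>
  let ?h = "G - ?g"
  have "\<exists>t>0. Z + t *\<^sub>R ?h \<in> param_space d H \<longrightarrow> Z + t *\<^sub>R ?h \<in> cell (pattern Z)"
    by (rule ex_small_step[OF eventually_in_cell_pattern[OF assms(2)]])
  then obtain t where t: "t > 0"
    "Z + t *\<^sub>R ?h \<in> param_space d H \<longrightarrow> Z + t *\<^sub>R ?h \<in> cell (pattern Z)" by blast
  have "Z + t *\<^sub>R ?h \<in> param_space d H"
    using assms(1,2) cell_grad_in_param_space[of "pattern Z" \<theta>]
    unfolding generic_def has_gradient_on_def
    by (intro subspace_add subspace_scale subspace_diff subspace_param_space) simp_all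
  then have "(Z + t *\<^sub>R ?h - \<theta>) \<bullet> G = (Z + t *\<^sub>R ?h - \<theta>) \<bullet> ?g"
    using t(2) dir by blast
  with dir[OF generic_in_cell[OF assms(2)]] have "t * (?h \<bullet> ?h) = 0"
    by (simp add: inner_diff_left inner_add_left inner_diff_right algebra_simps)
  then show ?thesis using t(1) by simp
qed

lemma adjacent_nonempty:
  assumes "\<theta> \<in> param_space d H"
  shows "adjacent \<theta> \<noteq> {}"
proof -
  obtain v where v: "v \<in> coord_space d UNIV" "\<And>i. i < N \<Longrightarrow> v \<bullet> x i \<noteq> 0"
    using ex_inner_nonzero[of "coord_space d UNIV" N x] subspace_coord_space[OF subspace_UNIV]
      data_space data_nonzero by blast
  \<comment> \<open>Shifting all neurons by the same small multiple of \<open>v\<close> resolves every vanishing pre-activation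
    and leaves the sign of the others unchanged.\<close>
  define q :: param where "q = (0, fseq_of H (\<lambda>_. v))"
  have q: "q \<in> param_space d H" "\<And>k i. k < H \<Longrightarrow> preact q k i = v \<bullet> x i"
    using v(1) by (auto simp: q_def param_space_def preact_def coord_space_def)
  have "\<exists>t>0. \<forall>k<H. \<forall>i<N.
     (preact \<theta> k i > 0 \<longrightarrow> preact (\<theta> + t *\<^sub>R q) k i > 0) \<and>
     (preact \<theta> k i < 0 \<longrightarrow> preact (\<theta> + t *\<^sub>R q) k i < 0)"
    by (rule ex_small_step[OF eventually_sign_preact])
  then obtain t where t: "t > 0" and sgn: "\<And>k i. k < H \<Longrightarrow> i < N \<Longrightarrow>
     (preact \<theta> k i > 0 \<longrightarrow> preact (\<theta> + t *\<^sub>R q) k i > 0) \<and>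
     (preact \<theta> k i < 0 \<longrightarrow> preact (\<theta> + t *\<^sub>R q) k i < 0)"
    by blast
  let ?Z = "\<theta> + t *\<^sub>R q"
  have "preact ?Z k i \<noteq> 0" if "k < H" "i < N" for k i
  proof (cases "preact \<theta> k i = 0")
    case True
    then show ?thesis using that t q(2) v(2) by (simp add: preact_add preact_scaleR)
  next
    case False
    then show ?thesis using sgn[OF that] by force
  qed
  moreover have "?Z \<in> param_space d H"
    using assms q(1) subspace_param_space[of d H] by (intro subspace_add subspace_scale)
  ultimately have "generic ?Z" by (simp add: generic_def)
  moreover have "\<theta> \<in> cell (pattern ?Z)"
    using assms sgn by (force simp: cell_def pattern_def not_less[symmetric])
  ultimately show ?thesis unfolding adjacent_def by blast
qed

text \<open>Nearby points see no cell that \<open>\<theta>\<close> itself does not see, because cells are closed and there are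
  only finitely many of them.\<close>
lemma eventually_adjacent_subset:
  assumes "\<theta> \<in> param_space d H"
  shows "\<forall>\<^sub>F \<theta>' in nhds \<theta>. adjacent \<theta>' \<subseteq> adjacent \<theta>"
  using eventually_sign_preact[of \<theta>]
proof (rule eventually_mono)
  fix \<theta>'
  assume *: "\<forall>k<H. \<forall>i<N.
     (preact \<theta> k i > 0 \<longrightarrow> preact \<theta>' k i > 0) \<and> (preact \<theta> k i < 0 \<longrightarrow> preact \<theta>' k i < 0)"
  have "\<theta> \<in> cell A" if "\<theta>' \<in> cell A" for A
    using that * assms by (auto simp: cell_def not_less[symmetric] split: if_splits)
  then show "adjacent \<theta>' \<subseteq> adjacent \<theta>" unfolding adjacent_def by blast
qed

lemma adjacent_cong:
  assumes "\<theta> \<in> param_space d H" "\<theta>' \<in> param_space d H"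
    and "\<And>k i. k < H \<Longrightarrow> i < N \<Longrightarrow> sgn (preact \<theta> k i) = sgn (preact \<theta>' k i)"
  shows "adjacent \<theta> = adjacent \<theta>'"
proof -
  have "(preact \<theta> k i \<ge> 0) = (preact \<theta>' k i \<ge> 0)" "(preact \<theta> k i \<le> 0) = (preact \<theta>' k i \<le> 0)"
    if "k < H" "i < N" for k i
    using assms(3)[OF that] by (auto simp: sgn_real_def split: if_splits)
  then have "\<theta> \<in> cell A \<longleftrightarrow> \<theta>' \<in> cell A" for A
    using assms(1,2) by (auto simp: cell_def)
  then show ?thesis by (simp add: adjacent_def)
qed

lemma finite_adjacent: "finite (adjacent \<theta>)"
  by (rule finite_subset[of _ "Pow ({..<H} \<times> {..<N})"]) (auto simp: adjacent_def pattern_def)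

end

section \<open>The Clarke subdifferential of the loss\<close>

context relu_network
begin

abbreviation "R \<equiv> data_radius N x"

lemma norm_data_le: "i < N \<Longrightarrow> norm (x i) \<le> R"
  unfolding data_radius_def by (intro Max_ge) auto

lemma data_radius_pos: "R > 0"
proof -
  have "0 < norm (x 0)" using data_nonzero[OF N_pos] by simp
  also have "\<dots> \<le> R" using norm_data_le[OF N_pos] .
  finally show ?thesis .
qed

lemma abs_inner_data_le: "i < N \<Longrightarrow> \<bar>v \<bullet> x i\<bar> \<le> R * norm v"
  using Cauchy_Schwarz_ineq2[of v "x i"] mult_left_mono[OF norm_data_le[of i], of "norm v"]
  by (simp add: mult.commute)

lemma norm_outer_weights_le: "norm (fst (\<theta> :: param)) \<le> norm \<theta>" and norm_hidden_weights_le: "norm (snd \<theta>) \<le> norm \<theta>"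
  using norm_fst_le[of "fst \<theta>" "snd \<theta>"] norm_snd_le[of "snd \<theta>" "fst \<theta>"] by simp_all

lemma abs_outer_le: "\<bar>coord (fst (\<theta> :: param)) k\<bar> \<le> norm \<theta>"
  using order_trans[OF norm_coord_le norm_outer_weights_le] by simp

lemma norm_weight_le: "norm (coord (snd (\<theta> :: param)) k) \<le> norm \<theta>"
  using order_trans[OF norm_coord_le norm_hidden_weights_le] by simp

lemma abs_preact_le: "i < N \<Longrightarrow> \<bar>preact \<theta> k i\<bar> \<le> R * norm \<theta>"
  unfolding preact_def
  using abs_inner_data_le mult_left_mono[OF norm_weight_le less_imp_le[OF data_radius_pos]]
  by (rule order_trans)

lemma lipschitz_constants_nonneg: "L0 \<ge> 0" "L1 \<ge> 0"
  using loss_lipschitz[OF N_pos] slope_lipschitz[OF N_pos] by (auto dest: lipschitz_on_nonneg)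

lemma abs_cell_slope_le: "i < N \<Longrightarrow> \<bar>cell_slope A \<theta> i\<bar> \<le> L0"
  unfolding cell_slope_def
  by (intro lipschitz_on_imp_abs_deriv_le loss_lipschitz loss_differentiable)

text \<open>Uniformity in the pattern \<open>A\<close> is the point of this estimate. It is used with \<open>\<theta>'\<close> tending to
  \<open>\<theta>\<close> while the pattern varies along the sequence, and for a point and its rounding. The
  two points are compared through their pre-activations and not through their weights, since for
  large \<open>\<delta>\<close> the rounded weights can be large in directions orthogonal to all the data.\<close>
lemma cell_grad_near:
  assumes outer: "\<And>k. k < H \<Longrightarrow> \<bar>coord (fst \<theta>) k\<bar> \<le> M"
    and pre: "\<And>k i. k < H \<Longrightarrow> i < N \<Longrightarrow> \<bar>preact \<theta> k i\<bar> \<le> R * M"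
    and pre': "\<And>k i. k < H \<Longrightarrow> i < N \<Longrightarrow> \<bar>preact \<theta>' k i\<bar> \<le> R * M"
    and outer_diff: "\<And>k. k < H \<Longrightarrow> \<bar>coord (fst \<theta>) k - coord (fst \<theta>') k\<bar> \<le> \<eta>"
    and pre_diff: "\<And>k i. k < H \<Longrightarrow> i < N \<Longrightarrow> \<bar>preact \<theta> k i - preact \<theta>' k i\<bar> \<le> R * \<eta>"
  shows "dist (cell_grad A \<theta>) (cell_grad A \<theta>')
    \<le> 2 * real H * real N * R * (2 * L1 * real H * M\<^sup>2 * R + L0) * \<eta>"
proof -
  define S where "S = L1 * (real H * (2 * R * M * \<eta>))"
  have act: "\<bar>cell_act A \<theta> k i\<bar> \<le> R * M" "\<bar>cell_act A \<theta>' k i\<bar> \<le> R * M"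
    "\<bar>cell_act A \<theta> k i - cell_act A \<theta>' k i\<bar> \<le> R * \<eta>" if "k < H" "i < N" for k i
    using pre[OF that] pre'[OF that] pre_diff[OF that] by (auto simp: cell_act_def)
  have slope: "\<bar>cell_slope A \<theta> i - cell_slope A \<theta>' i\<bar> \<le> S" if "i < N" for i
  proof -
    have "\<bar>coord (fst \<theta>) k * cell_act A \<theta> k i - coord (fst \<theta>') k * cell_act A \<theta>' k i\<bar> \<le> 2 * R * M * \<eta>"
      if "k < H" for k
    proof -
      have "\<bar>cell_act A \<theta> k i * coord (fst \<theta>) k - cell_act A \<theta>' k i * coord (fst \<theta>') k\<bar>
          \<le> (R * \<eta>) * M + (R * M) * \<eta>"
        using act[OF that \<open>i < N\<close>] outer[OF that] outer_diff[OF that] by (intro abs_mult_diff_le)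
      then show ?thesis by (simp add: mult.commute mult.left_commute)
    qed
    then have "\<bar>cell_output A \<theta> i - cell_output A \<theta>' i\<bar> \<le> real H * (2 * R * M * \<eta>)"
      unfolding cell_output_def sum_subtractf[symmetric]
      by (intro order_trans[OF sum_abs] sum_bounded_above[THEN order_trans]) auto
    moreover have "\<bar>cell_slope A \<theta> i - cell_slope A \<theta>' i\<bar> \<le> L1 * \<bar>cell_output A \<theta> i - cell_output A \<theta>' i\<bar>"
      using lipschitz_onD[OF slope_lipschitz[OF that]] by (simp add: cell_slope_def dist_real_def)
    ultimately show ?thesis
      unfolding S_def using lipschitz_constants_nonneg(2) by (meson mult_left_mono order_trans)
  qed
  let ?g = "cell_grad A \<theta>" and ?g' = "cell_grad A \<theta>'"
  have diff: "?g - ?g' \<in> param_space d H"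
    by (intro subspace_diff subspace_param_space cell_grad_in_param_space)
  have u: "norm (coord (fst (?g - ?g')) k) \<le> real N * (S * (R * M) + L0 * (R * \<eta>))" if "k < H" for k
  proof -
    have "\<bar>cell_slope A \<theta> i * cell_act A \<theta> k i - cell_slope A \<theta>' i * cell_act A \<theta>' k i\<bar>
        \<le> S * (R * M) + L0 * (R * \<eta>)" if "i < N" for i
      using slope abs_cell_slope_le act \<open>k < H\<close> that by (intro abs_mult_diff_le)
    then show ?thesis
      using that
      by (auto simp: cell_grad_def simp flip: sum_subtractf
          intro!: order_trans[OF sum_abs] sum_bounded_above[THEN order_trans])
  qed
  have w: "norm (coord (snd (?g - ?g')) k) \<le> real N * ((S * M + L0 * \<eta>) * R)" if "k < H" for k
  proof -
    define c where "c i = cell_slope A \<theta> i * coord (fst \<theta>) k * of_bool ((k, i) \<in> A)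
      - cell_slope A \<theta>' i * coord (fst \<theta>') k * of_bool ((k, i) \<in> A)" for i
    have "norm (c i *\<^sub>R x i) \<le> (S * M + L0 * \<eta>) * R" if "i < N" for i
    proof -
      have "\<bar>cell_slope A \<theta> i * coord (fst \<theta>) k - cell_slope A \<theta>' i * coord (fst \<theta>') k\<bar>
          \<le> S * M + L0 * \<eta>"
        using slope abs_cell_slope_le outer outer_diff \<open>k < H\<close> that by (intro abs_mult_diff_le)
      then have "\<bar>c i\<bar> \<le> S * M + L0 * \<eta>"
        by (auto simp: c_def)
      then show ?thesis
        using norm_data_le[OF that] by (auto intro!: mult_mono)
    qed
    then have "norm (\<Sum>i<N. c i *\<^sub>R x i) \<le> real N * ((S * M + L0 * \<eta>) * R)"
      by (intro order_trans[OF norm_sum] sum_bounded_above[THEN order_trans]) auto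
    then show ?thesis
      using that by (simp add: cell_grad_def c_def scaleR_left_diff_distrib sum_subtractf)
  qed
  have "dist ?g ?g' \<le> norm (fst (?g - ?g')) + norm (snd (?g - ?g'))"
    unfolding dist_norm
    by (rule norm_Pair_le[of "fst (?g - ?g')" "snd (?g - ?g')", unfolded prod.collapse])
  also have "\<dots> \<le> (\<Sum>k<H. norm (coord (fst (?g - ?g')) k)) + (\<Sum>k<H. norm (coord (snd (?g - ?g')) k))"
  proof (intro add_mono norm_le_sum_coord)
    show "fst (?g - ?g') \<in> coord_space H UNIV" "snd (?g - ?g') \<in> coord_space H UNIV"
      using diff unfolding param_space_def mem_Times_iff coord_space_def by blast+
  qed
  also have "\<dots> \<le> real H * (real N * (S * (R * M) + L0 * (R * \<eta>)))
      + real H * (real N * ((S * M + L0 * \<eta>) * R))"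
    using u w by (intro add_mono sum_bounded_above[THEN order_trans]) auto
  also have "\<dots> = 2 * real H * real N * R * (2 * L1 * real H * M\<^sup>2 * R + L0) * \<eta>"
    by (simp add: S_def algebra_simps power2_eq_square)
  finally show ?thesis .
qed

lemma dist_cell_grad_tendsto_0:
  assumes "X \<longlonglongrightarrow> \<theta>"
  shows "(\<lambda>n. dist (cell_grad (A n) (X n)) (cell_grad (A n) \<theta>)) \<longlonglongrightarrow> 0"
proof -
  define M where "M = norm \<theta> + 1"
  define C where "C = 2 * real H * real N * R * (2 * L1 * real H * M\<^sup>2 * R + L0)"
  have "\<forall>\<^sub>F n in sequentially. dist (X n) \<theta> < 1"
    using tendstoD[OF assms, of 1] by simp
  then have "\<forall>\<^sub>F n in sequentially.
    norm (dist (cell_grad (A n) (X n)) (cell_grad (A n) \<theta>)) \<le> C * dist (X n) \<theta>"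
  proof (rule eventually_mono)
    fix n assume "dist (X n) \<theta> < 1"
    then have X: "norm (X n) \<le> M"
      using norm_triangle_ineq2[of "X n" \<theta>] by (simp add: M_def dist_norm)
    have \<theta>: "norm \<theta> \<le> M" by (simp add: M_def)
    note scale = mult_left_mono[OF _ less_imp_le[OF data_radius_pos]]
    have "dist (cell_grad (A n) (X n)) (cell_grad (A n) \<theta>) \<le> C * dist (X n) \<theta>"
      unfolding C_def
    proof (rule cell_grad_near)
      fix k i assume "i < N"
      show "\<bar>preact (X n) k i\<bar> \<le> R * M" "\<bar>preact \<theta> k i\<bar> \<le> R * M"
        using order_trans[OF abs_preact_le[OF \<open>i < N\<close>] scale] X \<theta> by blast+
      show "\<bar>preact (X n) k i - preact \<theta> k i\<bar> \<le> R * dist (X n) \<theta>"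
        using abs_preact_le[OF \<open>i < N\<close>, of "X n - \<theta>" k] by (simp add: preact_diff dist_norm)
    next
      fix k
      show "\<bar>coord (fst (X n)) k\<bar> \<le> M" using abs_outer_le[of "X n" k] X by simp
      show "\<bar>coord (fst (X n)) k - coord (fst \<theta>) k\<bar> \<le> dist (X n) \<theta>"
        using abs_outer_le[of "X n - \<theta>" k] by (simp add: dist_norm)
    qed
    then show "norm (dist (cell_grad (A n) (X n)) (cell_grad (A n) \<theta>)) \<le> C * dist (X n) \<theta>"
      by simp
  qed
  moreover have "(\<lambda>n. C * dist (X n) \<theta>) \<longlonglongrightarrow> 0"
    by (intro tendsto_mult_right_zero tendsto_dist_iff[THEN iffD1, OF assms])
  ultimately show ?thesis by (rule Lim_null_comparison)
qed

text \<open>The description of the subdifferential on which everything rests: \<open>\<theta>\<close> enters only through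
  the finite set \<open>adjacent \<theta>\<close> of patterns and through the smooth map \<open>cell_grad A\<close>. A limit of
  gradients is a limit of \<open>cell_grad\<close> values at \<open>\<theta>\<close>, and these form a finite, hence closed, set. Conversely each
  of them is approached from the interior of its cell.\<close>
theorem clarke_subdiff_loss:
  assumes "\<theta> \<in> param_space d H"
  shows "clarke_subdiff (param_space d H) (loss l N x y H) \<theta>
    = convex hull ((\<lambda>A. cell_grad A \<theta>) ` adjacent \<theta>)"
proof -
  let ?V = "param_space d H" and ?L = "loss l N x y H"
  have "(\<exists>X G. (\<forall>n::nat. X n \<in> ?V \<and> has_gradient_on ?L (G n) ?V (X n)) \<and> X \<longlonglongrightarrow> \<theta> \<and> G \<longlonglongrightarrow> s)
    \<longleftrightarrow> s \<in> (\<lambda>A. cell_grad A \<theta>) ` adjacent \<theta>" for s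
  proof
    assume "\<exists>X G. (\<forall>n::nat. X n \<in> ?V \<and> has_gradient_on ?L (G n) ?V (X n)) \<and> X \<longlonglongrightarrow> \<theta> \<and> G \<longlonglongrightarrow> s"
    then obtain X G where X: "\<And>n::nat. X n \<in> ?V" and G: "\<And>n. has_gradient_on ?L (G n) ?V (X n)"
      and lim: "X \<longlonglongrightarrow> \<theta>" "G \<longlonglongrightarrow> s" by blast
    have "\<forall>n. \<exists>A. A \<in> adjacent (X n)" using adjacent_nonempty X by blast
    then obtain A where A: "\<And>n. A n \<in> adjacent (X n)" by metis
    have "G n = cell_grad (A n) (X n)" for n
    proof -
      obtain Z where "A n = pattern Z" "generic Z" "X n \<in> cell (pattern Z)"
        using A[of n] unfolding adjacent_def by blast
      then show ?thesis using gradient_eq_cell_grad[OF G[of n]] by simp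
    qed
    then have "(\<lambda>n. dist (G n) (cell_grad (A n) \<theta>)) \<longlonglongrightarrow> 0"
      using dist_cell_grad_tendsto_0[OF lim(1)] by simp
    then have "(\<lambda>n. cell_grad (A n) \<theta> - G n) \<longlonglongrightarrow> 0"
      unfolding dist_norm norm_minus_commute[of "G _"] by (rule tendsto_norm_zero_cancel)
    with lim(2) have conv: "(\<lambda>n. cell_grad (A n) \<theta>) \<longlonglongrightarrow> s"
      by (rule Lim_transform)
    have ev: "\<forall>\<^sub>F n in sequentially. cell_grad (A n) \<theta> \<in> (\<lambda>A. cell_grad A \<theta>) ` adjacent \<theta>"
      using eventually_compose_filterlim[OF eventually_adjacent_subset[OF assms] lim(1)]
      by (rule eventually_mono) (use A in blast)
    have "closed ((\<lambda>A. cell_grad A \<theta>) ` adjacent \<theta>)"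
      by (intro finite_imp_closed finite_imageI finite_adjacent)
    then show "s \<in> (\<lambda>A. cell_grad A \<theta>) ` adjacent \<theta>"
      by (rule Lim_in_closed_set[OF _ ev _ conv]) simp
  next
    assume "s \<in> (\<lambda>A. cell_grad A \<theta>) ` adjacent \<theta>"
    then obtain Z where Z: "generic Z" "\<theta> \<in> cell (pattern Z)" and s: "s = cell_grad (pattern Z) \<theta>"
      unfolding adjacent_def by blast
    define X where "X n = \<theta> + inverse (real (Suc n)) *\<^sub>R (Z - \<theta>)" for n
    define G where "G n = cell_grad (pattern Z) (X n)" for n
    have X: "generic (X n)" "pattern (X n) = pattern Z" for n
      unfolding X_def using generic_segment[OF Z, of "inverse (real (Suc n))"]
      by (simp_all add: inverse_le_1_iff)
    have "X \<longlonglongrightarrow> \<theta> + 0 *\<^sub>R (Z - \<theta>)"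
      unfolding X_def
      by (intro tendsto_add tendsto_const tendsto_scaleR LIMSEQ_inverse_real_of_nat)
    then have lim: "X \<longlonglongrightarrow> \<theta>" by simp
    have "G \<longlonglongrightarrow> s"
      unfolding G_def s tendsto_dist_iff[of _ "cell_grad _ \<theta>"]
      by (rule dist_cell_grad_tendsto_0[OF lim, of "\<lambda>_. pattern Z"])
    moreover have "X n \<in> ?V \<and> has_gradient_on ?L (G n) ?V (X n)" for n
      using has_gradient_at_generic[OF X(1)[of n]] X[of n] by (simp add: G_def generic_def)
    ultimately show "\<exists>X G. (\<forall>n::nat. X n \<in> ?V \<and> has_gradient_on ?L (G n) ?V (X n)) \<and> X \<longlonglongrightarrow> \<theta> \<and> G \<longlonglongrightarrow> s"
      using lim by blast
  qed
  then show ?thesis unfolding clarke_subdiff_def by simp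
qed

end

section \<open>The rounding step\<close>

text \<open>Only feasible points that are at least as close to \<open>w\<close> as \<open>z0\<close> compete for the minimum. They form a
  compact set, so \<open>ARG_MIN\<close> denotes an actual minimizer.\<close>
lemma round_minimizer:
  fixes w z0 :: "real fseq"
  assumes "z0 \<in> round_feasible d N x \<delta> w"
  defines "z \<equiv> ARG_MIN (\<lambda>z. (norm (z - w))\<^sup>2) z. z \<in> round_feasible d N x \<delta> w"
  shows "z \<in> round_feasible d N x \<delta> w" "norm (z - w) \<le> norm (z0 - w)"
proof -
  let ?F = "round_feasible d N x \<delta> w" and ?R = "data_radius N x"
  define C where "C = {z. \<forall>i<N.
         (x i \<bullet> w > ?R * \<delta> \<longrightarrow> z \<bullet> x i \<ge> 2 * ?R * \<delta>) \<and>
         (x i \<bullet> w < - (?R * \<delta>) \<longrightarrow> z \<bullet> x i \<le> - (2 * ?R * \<delta>)) \<and>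
         (\<bar>x i \<bullet> w\<bar> \<le> ?R * \<delta> \<longrightarrow> z \<bullet> x i = 0)}"
  have F: "?F = coord_space d UNIV \<inter> C"
    by (auto simp: round_feasible_def C_def Let_def)
  define r where "r = norm w + norm (z0 - w)"
  define K where "K = coord_space d {-r..r} \<inter> (C \<inter> cball w (norm (z0 - w)))"
  have "closed C"
    unfolding C_def
    by (intro closed_Collect_all closed_Collect_imp closed_Collect_conj open_Collect_const
        closed_Collect_le closed_Collect_eq continuous_on_const continuous_on_inner continuous_on_id)
  then have "compact K"
    unfolding K_def by (intro compact_Int_closed compact_coord_space closed_Int) auto
  have in_K: "v \<in> K" if "v \<in> ?F" "norm (v - w) \<le> norm (z0 - w)" for v
  proof -
    have "norm v \<le> r" using norm_triangle_ineq[of w "v - w"] that(2) by (simp add: r_def)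
    then have "coord v i \<in> {-r..r}" for i using norm_coord_le[of v i] by auto
    then show ?thesis using that
      by (auto simp: F K_def coord_space_def dist_norm norm_minus_commute)
  qed
  have K_sub: "K \<subseteq> ?F" by (auto simp: F K_def coord_space_def)
  have "z0 \<in> K" using in_K assms(1) by simp
  moreover have "continuous_on K (\<lambda>v. (norm (v - w))\<^sup>2)"
    by (intro continuous_intros)
  ultimately obtain m where m: "m \<in> K" "\<And>v. v \<in> K \<Longrightarrow> (norm (m - w))\<^sup>2 \<le> (norm (v - w))\<^sup>2"
    using continuous_attains_inf[OF \<open>compact K\<close>] by blast
  have "is_arg_min (\<lambda>z. (norm (z - w))\<^sup>2) (\<lambda>z. z \<in> ?F) m"
    unfolding is_arg_min_linorder
  proof (intro conjI allI impI)
    show "m \<in> ?F" using m(1) K_sub by blast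
    fix v assume v: "v \<in> ?F"
    show "(norm (m - w))\<^sup>2 \<le> (norm (v - w))\<^sup>2"
    proof (cases "norm (v - w) \<le> norm (z0 - w)")
      case True
      then show ?thesis using m(2) in_K v by blast
    next
      case False
      then have "(norm (z0 - w))\<^sup>2 \<le> (norm (v - w))\<^sup>2" by (intro power_mono) auto
      with m(2)[OF \<open>z0 \<in> K\<close>] show ?thesis by simp
    qed
  qed
  then have "is_arg_min (\<lambda>z. (norm (z - w))\<^sup>2) (\<lambda>z. z \<in> ?F) z"
    unfolding z_def arg_min_def by (rule someI)
  then show "z \<in> ?F" "norm (z - w) \<le> norm (z0 - w)"
    using assms(1) unfolding is_arg_min_linorder by (auto intro: power2_le_imp_le)
qed

context relu_network
begin

lemma separation:
  assumes "ereal \<delta> \<le> separation_const N x H \<theta>" "k < H" "i < N" "preact \<theta> k i \<noteq> 0"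
  shows "4 * R * \<delta> \<le> \<bar>preact \<theta> k i\<bar>"
proof -
  let ?S = "{\<bar>x i \<bullet> coord (snd \<theta>) k\<bar> | i k. i < N \<and> k < H \<and> x i \<bullet> coord (snd \<theta>) k \<noteq> 0}"
  have "?S \<subseteq> (\<lambda>(i, k). \<bar>x i \<bullet> coord (snd \<theta>) k\<bar>) ` ({..<N} \<times> {..<H})" by auto
  then have "finite ?S" by (rule finite_subset) auto
  moreover have mem: "\<bar>preact \<theta> k i\<bar> \<in> ?S"
    using assms(2-4) by (auto simp: preact_def inner_commute)
  ultimately have "Min ?S \<le> \<bar>preact \<theta> k i\<bar>" by (rule Min_le)
  moreover have "separation_const N x H \<theta> = ereal (1 / (4 * R) * Min ?S)"
    unfolding separation_const_def Let_def by (rule if_not_P) (use mem in blast)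
  then have "\<delta> \<le> 1 / (4 * R) * Min ?S" using assms(1) by simp
  then have "4 * R * \<delta> \<le> Min ?S"
    using data_radius_pos by (simp add: field_simps)
  ultimately show ?thesis by simp
qed

text \<open>Each pre-activation moves by at most \<open>R * \<delta>\<close> between \<open>\<theta>s\<close> and \<open>\<theta>\<close>, while at \<open>\<theta>s\<close> it is either
  zero or at least \<open>4 * R * \<delta>\<close> in size. The threshold \<open>R * \<delta>\<close> of the procedure therefore reads off the
  sign at \<open>\<theta>s\<close> correctly. It follows that the weights of \<open>\<theta>s\<close> are feasible, so the minimizer is no
  farther from the weights of \<open>\<theta>\<close> than they are, and that the constraints force the signs of \<open>\<theta>s\<close> on
  the rounded point.\<close>
lemma round_params_close:
  assumes \<theta>s: "\<theta>s \<in> param_space d H" and \<theta>: "\<theta> \<in> param_space d H" "dist \<theta>s \<theta> \<le> \<delta>"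
    and \<delta>: "0 < \<delta>" "ereal \<delta> \<le> separation_const N x H \<theta>s"
  defines "\<theta>r \<equiv> round_params d N x H \<delta> \<theta>"
  shows "\<theta>r \<in> param_space d H"
    and "\<And>k i. k < H \<Longrightarrow> i < N \<Longrightarrow> sgn (preact \<theta>s k i) = sgn (preact \<theta>r k i)"
    and "\<And>k. \<bar>coord (fst \<theta>s) k - coord (fst \<theta>r) k\<bar> \<le> \<delta>"
    and "\<And>k i. k < H \<Longrightarrow> i < N \<Longrightarrow> \<bar>preact \<theta>s k i - preact \<theta>r k i\<bar> \<le> R * (2 * \<delta>)"
proof -
  let ?w = "\<lambda>k. coord (snd \<theta>) k" and ?ws = "\<lambda>k. coord (snd \<theta>s) k" and ?wr = "\<lambda>k. coord (snd \<theta>r) k"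
  have R\<delta>: "R * \<delta> > 0" using data_radius_pos \<delta>(1) by simp
  have pre: "\<bar>preact \<theta>s k i - preact \<theta> k i\<bar> \<le> R * \<delta>" if "i < N" for k i
  proof -
    have "\<bar>preact (\<theta>s - \<theta>) k i\<bar> \<le> R * norm (\<theta>s - \<theta>)" by (rule abs_preact_le[OF that])
    also have "\<dots> \<le> R * \<delta>"
      using \<theta>(2) data_radius_pos by (simp add: dist_norm)
    finally show ?thesis by (simp add: preact_diff)
  qed
  have sep: "preact \<theta>s k i = 0 \<or> \<bar>preact \<theta>s k i\<bar> \<ge> 4 * (R * \<delta>)" if "k < H" "i < N" for k i
    using separation[OF \<delta>(2) that] by (auto simp: mult.assoc)
  have feas: "?ws k \<in> round_feasible d N x \<delta> (?w k)" if "k < H" for k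
  proof -
    have "(preact \<theta> k i > R * \<delta> \<longrightarrow> preact \<theta>s k i \<ge> 2 * (R * \<delta>)) \<and>
         (preact \<theta> k i < - (R * \<delta>) \<longrightarrow> preact \<theta>s k i \<le> - (2 * (R * \<delta>))) \<and>
         (\<bar>preact \<theta> k i\<bar> \<le> R * \<delta> \<longrightarrow> preact \<theta>s k i = 0)" if "i < N" for i
      using pre[OF that, of k] sep[OF \<open>k < H\<close> that] R\<delta> by linarith
    moreover have "?ws k \<in> coord_space d UNIV"
      using \<theta>s that by (auto simp: param_space_def coord_space_def)
    ultimately show ?thesis
      by (simp add: round_feasible_def Let_def preact_def inner_commute mult.assoc)
  qed
  have wr: "?wr k = (ARG_MIN (\<lambda>z. (norm (z - ?w k))\<^sup>2) z. z \<in> round_feasible d N x \<delta> (?w k))"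
    if "k < H" for k
    using that by (simp add: \<theta>r_def round_params_def)
  have wr_feas: "?wr k \<in> round_feasible d N x \<delta> (?w k)"
    and wr_near: "norm (?wr k - ?w k) \<le> norm (?ws k - ?w k)" if "k < H" for k
    unfolding wr[OF that] by (rule round_minimizer[OF feas[OF that]])+
  show "\<theta>r \<in> param_space d H"
  proof -
    have "?wr k \<in> coord_space d UNIV" if "k < H" for k
      using wr_feas[OF that] by (simp add: round_feasible_def Let_def)
    moreover have "?wr k = 0" if "k \<ge> H" for k
      using that by (simp add: \<theta>r_def round_params_def)
    moreover have "fst \<theta>r \<in> coord_space H UNIV"
      using \<theta>(1) by (auto simp: \<theta>r_def round_params_def param_space_def)
    ultimately show ?thesis by (simp add: param_space_def mem_Times_iff coord_space_def[of H])
  qed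
  show "sgn (preact \<theta>s k i) = sgn (preact \<theta>r k i)" if "k < H" "i < N" for k i
  proof -
    have "(preact \<theta> k i > R * \<delta> \<longrightarrow> preact \<theta>r k i \<ge> 2 * (R * \<delta>)) \<and>
         (preact \<theta> k i < - (R * \<delta>) \<longrightarrow> preact \<theta>r k i \<le> - (2 * (R * \<delta>))) \<and>
         (\<bar>preact \<theta> k i\<bar> \<le> R * \<delta> \<longrightarrow> preact \<theta>r k i = 0)"
      using wr_feas[OF that(1)] that(2)
      by (simp add: round_feasible_def Let_def preact_def inner_commute mult.assoc)
    then have "preact \<theta>s k i > 0 \<longrightarrow> preact \<theta>r k i > 0" "preact \<theta>s k i < 0 \<longrightarrow> preact \<theta>r k i < 0"
      "preact \<theta>s k i = 0 \<longrightarrow> preact \<theta>r k i = 0"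
      using pre[OF that(2), of k] sep[OF that] R\<delta> by linarith+
    then show ?thesis
      by (cases "preact \<theta>s k i" "0 :: real" rule: linorder_cases) simp_all
  qed
  show "\<bar>coord (fst \<theta>s) k - coord (fst \<theta>r) k\<bar> \<le> \<delta>" for k
    using abs_outer_le[of "\<theta>s - \<theta>" k] \<theta>(2) by (simp add: \<theta>r_def round_params_def dist_norm)
  show "\<bar>preact \<theta>s k i - preact \<theta>r k i\<bar> \<le> R * (2 * \<delta>)" if "k < H" "i < N" for k i
  proof -
    have "norm (?ws k - ?w k) \<le> \<delta>"
      using norm_weight_le[of "\<theta>s - \<theta>" k] \<theta>(2) by (simp add: dist_norm)
    then have "norm (?ws k - ?wr k) \<le> 2 * \<delta>"
      using norm_triangle_ineq4[of "?ws k - ?w k" "?wr k - ?w k"] wr_near[OF that(1)] by simp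
    then have "R * norm (?ws k - ?wr k) \<le> R * (2 * \<delta>)"
      using data_radius_pos by simp
    with abs_inner_data_le[OF that(2), of "?ws k - ?wr k"] show ?thesis
      by (simp add: preact_def inner_diff_left)
  qed
qed

text \<open>Equal signs of the pre-activations give equal sets of adjacent patterns, so the two
  subdifferentials are convex hulls of families with the same index set, whose members
  are close by \<open>cell_grad_near\<close>.\<close>
theorem rounding_stationarity:
  assumes \<theta>s: "\<theta>s \<in> param_space d H" and \<theta>: "\<theta> \<in> param_space d H" "dist \<theta>s \<theta> \<le> \<delta>"
    and \<delta>: "0 < \<delta>" "ereal \<delta> \<le> separation_const N x H \<theta>s"
  defines "\<theta>r \<equiv> round_params d N x H \<delta> \<theta>"
  shows "infdist 0 (clarke_subdiff (param_space d H) (loss l N x y H) \<theta>r)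
    \<le> infdist 0 (clarke_subdiff (param_space d H) (loss l N x y H) \<theta>s)
      + 4 * real H * real N * R * (9/2 * L1 * real H * (norm \<theta>s)\<^sup>2 * R + L0) * \<delta>"
proof -
  \<comment> \<open>A nonzero pre-activation at \<open>\<theta>s\<close> is at least \<open>4 * R * \<delta>\<close> and changes by at most \<open>2 * R * \<delta>\<close>,
    hence grows by a factor of at most \<open>3/2\<close>; a zero one stays zero. This keeps \<open>\<delta>\<close> out
    of the constant even when the separation constant is infinite and \<open>\<delta>\<close> is arbitrarily large.\<close>
  let ?M = "3/2 * norm \<theta>s"
  note close = round_params_close[OF \<theta>s \<theta> \<delta>, folded \<theta>r_def]
  have adj: "adjacent \<theta>s = adjacent \<theta>r"
    using close(2) by (intro adjacent_cong \<theta>s close(1))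
  have near: "dist (cell_grad A \<theta>s) (cell_grad A \<theta>r)
    \<le> 2 * real H * real N * R * (2 * L1 * real H * ?M\<^sup>2 * R + L0) * (2 * \<delta>)" for A
  proof (rule cell_grad_near)
    fix k i assume ki: "k < H" "i < N"
    show pre: "\<bar>preact \<theta>s k i\<bar> \<le> R * ?M"
      using abs_preact_le[OF ki(2), of \<theta>s k] data_radius_pos
        mult_nonneg_nonneg[OF less_imp_le[OF data_radius_pos] norm_ge_zero[of \<theta>s]] by simp
    show "\<bar>preact \<theta>r k i\<bar> \<le> R * ?M"
    proof (cases "preact \<theta>s k i = 0")
      case True
      then have "preact \<theta>r k i = 0" using close(2)[OF ki] by (simp add: sgn_0_0)
      then show ?thesis using data_radius_pos by simp
    next
      case False
      then show ?thesis
        using separation[OF \<delta>(2) ki False] abs_preact_le[OF ki(2), of \<theta>s k] close(4)[OF ki] by simp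
    qed
  next
    fix k
    show "\<bar>coord (fst \<theta>s) k\<bar> \<le> ?M" using abs_outer_le[of \<theta>s k] by simp
    show "\<bar>coord (fst \<theta>s) k - coord (fst \<theta>r) k\<bar> \<le> 2 * \<delta>" using close(3)[of k] \<delta>(1) by simp
  qed (use close(4) in auto)
  have "infdist 0 (clarke_subdiff (param_space d H) (loss l N x y H) \<theta>r)
    \<le> infdist 0 (clarke_subdiff (param_space d H) (loss l N x y H) \<theta>s)
      + 2 * real H * real N * R * (2 * L1 * real H * ?M\<^sup>2 * R + L0) * (2 * \<delta>)"
    unfolding clarke_subdiff_loss[OF \<theta>s] clarke_subdiff_loss[OF close(1)] adj
    using adjacent_nonempty[OF close(1)] near
    by (intro infdist_le_infdist_add convex_hull_image_near) simp_all
  then show ?thesis by (simp add: power2_eq_square algebra_simps)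
qed

end

section \<open>Rounding preserves near-stationarity\<close>

theorem theorem28:
  shows "\<exists>P :: real \<times> real \<times> real \<times> real \<times> real \<times> real \<Rightarrow> real. real_polynomial_function P \<and>
    (\<forall>(d::nat) (N::nat) (H::nat) (x :: nat \<Rightarrow> real fseq) (y :: nat \<Rightarrow> real)
       (l :: real \<times> real \<Rightarrow> real) (L0::real) (L1::real)
       (\<theta>s :: param) (\<epsilon>::real) (\<delta>::real) (\<theta> :: param).
       let B = norm \<theta>s;
           R = data_radius N x;
           V = param_space d H;
           L = loss l N x y H;
           \<theta>r = round_params d N x H \<delta> \<theta>
       in
         N > 0 \<longrightarrow>
         (\<forall>i<N. x i \<in> coord_space d UNIV \<and> x i \<noteq> 0) \<longrightarrow>
         locally_lipschitz_gradient l \<longrightarrow>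
         (\<forall>i<N. L0-lipschitz_on UNIV (\<lambda>t. l (t, y i)) \<and>
                L1-lipschitz_on UNIV (deriv (\<lambda>t. l (t, y i)))) \<longrightarrow>
         \<theta>s \<in> V \<longrightarrow>
         infdist 0 (clarke_subdiff V L \<theta>s) \<le> \<epsilon> \<longrightarrow>
         SQ l N x y H \<theta>s \<longrightarrow>
         0 < \<delta> \<longrightarrow> ereal \<delta> \<le> separation_const N x H \<theta>s \<longrightarrow>
         \<theta> \<in> V \<inter> cball \<theta>s \<delta> \<longrightarrow>
         SQ l N x y H \<theta>r \<longrightarrow>
         infdist 0 (clarke_subdiff V L \<theta>r) \<le> \<epsilon> + P (B, R, L0, L1, real N, real H) * \<delta>)"
proof -
  \<comment> \<open>\<open>P (B, R, L0, L1, N, H) = 4 * H * N * R * (9/2 * L1 * H * B\<^sup>2 * R + L0)\<close>, written with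
    projections so that it is visibly built from linear maps.\<close>
  define P :: "real \<times> real \<times> real \<times> real \<times> real \<times> real \<Rightarrow> real" where
    "P = (\<lambda>p. 4 * snd (snd (snd (snd (snd p)))) * fst (snd (snd (snd (snd p)))) * fst (snd p) *
      (9/2 * fst (snd (snd (snd p))) * snd (snd (snd (snd (snd p)))) * (fst p)\<^sup>2 * fst (snd p)
        + fst (snd (snd p))))"
  have "real_polynomial_function P"
    unfolding P_def
    by (intro real_polynomial_function.intros(2-4) real_polynomial_function_power
        real_polynomial_function.intros(1) bounded_linear_fst_comp bounded_linear_snd_comp
        bounded_linear_fst bounded_linear_snd)
  moreover have "infdist 0 (clarke_subdiff (param_space d H) (loss l N x y H) (round_params d N x H \<delta> \<theta>))
      \<le> \<epsilon> + P (norm \<theta>s, data_radius N x, L0, L1, real N, real H) * \<delta>"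
    if "N > 0" "\<forall>i<N. x i \<in> coord_space d UNIV \<and> x i \<noteq> 0" "locally_lipschitz_gradient l"
      "\<forall>i<N. L0-lipschitz_on UNIV (\<lambda>t. l (t, y i)) \<and> L1-lipschitz_on UNIV (deriv (\<lambda>t. l (t, y i)))"
      "\<theta>s \<in> param_space d H" "infdist 0 (clarke_subdiff (param_space d H) (loss l N x y H) \<theta>s) \<le> \<epsilon>"
      "0 < \<delta>" "ereal \<delta> \<le> separation_const N x H \<theta>s" "\<theta> \<in> param_space d H \<inter> cball \<theta>s \<delta>"
    for d N H x y l L0 L1 \<theta>s \<epsilon> \<delta> \<theta>
  proof -
    note hyps = that
    have "(\<lambda>t. l (t, y i)) differentiable at t" for i t
    proof -
      obtain g where "\<And>p. GDERIV l p :> g p"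
        using hyps(3) unfolding locally_lipschitz_gradient_def by blast
      then have "(l has_derivative (\<lambda>h. h \<bullet> g (t, y i))) (at (t, y i))"
        unfolding gderiv_def by blast
      with has_derivative_Pair[OF has_derivative_ident has_derivative_const]
      have "((\<lambda>t. l (t, y i)) has_derivative (\<lambda>h. (h, 0) \<bullet> g (t, y i))) (at t)"
        by (rule has_derivative_compose)
      then show ?thesis by (rule differentiableI)
    qed
    with hyps interpret relu_network l d N H x y L0 L1
      by unfold_locales auto
    show ?thesis
      using rounding_stationarity[of \<theta>s \<theta> \<delta>] hyps by (simp add: P_def)
  qed
  ultimately show ?thesis
    unfolding Let_def by (intro exI[of _ P]) blast
qed

end
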